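(* Let $q$ be a prime power and let $0 \le t < k$ be integers. Let $g \in \mathbb{F}_q[X]$ be a monic polynomial of degree $t$ with $g(0)\neq 0$. Let $\mathrm{CF}_{k,g}(\mathbb{F}_q)$ be the family of all sets $S$ of monic polynomials in $\mathbb{F}_q[X]$ of degree $k$ with nonzero constant term such that $\gcd(f_1,f_2)=g$ for all distinct $f_1,f_2\in S$. Then: (i) The maximum cardinality of such a set is $$\max_{S\in \mathrm{CF}_{k,g}(\mathbb{F}_q)} |S| = I_{k-t} + \sum_{i=1}^{\lfloor (k-t)/2 \rfloor} I_i,$$ where, for all $n\ge 1$, $I_n$ is the number of (monic) irreducible polynomials of degree $n$ over $\mathbb{F}_q$, given by Gauss's formula $$I_n = \frac{1}{n}\sum_{d\mid n}\mu(d)\,q^{n/d},$$ with $\mu$ the Möbius function. (ii) For every $S\in\mathrm{CF}_{k,g}(\mathbb{F}_q)$ with $|S|\ge 2$, the Grassmannian code $\mathcal{C}_S=\{\ker(F_P) : P\in S\}$ is equidistant with minimum distance $2k-2t$, i.e. any two distinct elements of $\mathcal{C}_S$ are at distance exactly $2k-2t$.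
   Context: $\mathbb{F}_q$ is the finite field with $q$ elements. GCDs are taken monic. For a monic polynomial $P(X)=a_0+a_1X+\cdots+a_kX^k\in\mathbb{F}_q[X]$ of degree $k$ (so $a_k=1$) with $a_0\ne0$, $F_P:\mathbb{F}_q^{2k}\to\mathbb{F}_q^k$ denotes the linear cellular automaton of length $2k$ with local rule given by the coefficients of $P$, i.e. $F_P(x_0,\dots,x_{2k-1})_i = a_0x_i+a_1x_{i+1}+\cdots+a_kx_{i+k}$ for $0\le i\le k-1$. The distance between subspaces $A,B$ of $\mathbb{F}_q^{2k}$ is $d(A,B)=\dim A+\dim B-2\dim(A\cap B)$. A Grassmannian code is a set of subspaces of $\mathbb{F}_q^{2k}$ all of the same dimension.
   Formalization: In (i) the irreducible polynomials counted in the maximum exclude X (nonzero constant term), so the maximum is one less than the printed formula with Gauss's I_n, which is false as printed (q=2, k=1, t=0, g=1 gives 1, not I_1=2). *)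

theory Defs
  imports
    "HOL-Library.Cardinality"
    "HOL-Computational_Algebra.Polynomial_Factorial"
    "HOL-Computational_Algebra.Squarefree"
    "Jordan_Normal_Form.VS_Connect"
begin

definition moebius :: "nat \<Rightarrow> int" where
  "moebius n = (if squarefree n then (- 1) ^ card (prime_factors n) else 0)"

definition monic_irreducibles :: "'a::field itself \<Rightarrow> nat \<Rightarrow> 'a poly set" where
  "monic_irreducibles _ n = {p. irreducible p \<and> lead_coeff p = 1 \<and> degree p = n}"

definition num_irreducible :: "'a::field itself \<Rightarrow> nat \<Rightarrow> nat" where
  "num_irreducible F n = card (monic_irreducibles F n)"

text \<open>Only the irreducible polynomials other than \<open>X\<close> can divide a polynomial with nonzero
  constant term. The two counts differ only in degree 1, where \<open>num_irreducible\<close> is \<open>q\<close> and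
  \<open>num_irreducible_nz\<close> is \<open>q - 1\<close>.\<close>

definition num_irreducible_nz :: "'a::field itself \<Rightarrow> nat \<Rightarrow> nat" where
  "num_irreducible_nz F n = card {p \<in> monic_irreducibles F n. poly p 0 \<noteq> 0}"

text \<open>The library \<open>gcd\<close> on polynomials over a \<open>field_gcd\<close> is the monic one:\<close>

lemma lead_coeff_gcd_field:
  fixes p q :: "'a::field_gcd poly"
  assumes "p \<noteq> 0 \<or> q \<noteq> 0"
  shows "lead_coeff (gcd p q) = 1"
proof -
  have nz: "gcd p q \<noteq> 0" using assms by auto
  then have "unit_factor (gcd p q) = 1" by (simp add: unit_factor_gcd)
  then have "unit_factor (lead_coeff (gcd p q)) = 1"
    by (simp add: unit_factor_poly_def one_pCons)
  moreover have "unit_factor (lead_coeff (gcd p q)) = lead_coeff (gcd p q)"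
    using nz by (intro is_unit_unit_factor) (simp add: dvd_field_iff)
  ultimately show ?thesis by simp
qed

definition CF :: "nat \<Rightarrow> 'a::field_gcd poly \<Rightarrow> 'a poly set set" where
  "CF k g = {S. S \<subseteq> {p. lead_coeff p = 1 \<and> degree p = k \<and> poly p 0 \<noteq> 0} \<and>
                pairwise (\<lambda>f\<^sub>1 f\<^sub>2. gcd f\<^sub>1 f\<^sub>2 = g) S}"

definition linear_CA :: "'a::field poly \<Rightarrow> 'a vec \<Rightarrow> 'a vec" where
  "linear_CA p x = vec (degree p) (\<lambda>i. \<Sum>j\<le>degree p. coeff p j * x $ (i + j))"

definition CA_kernel :: "'a::field poly \<Rightarrow> 'a vec set" where
  "CA_kernel p = {x \<in> carrier_vec (2 * degree p). linear_CA p x = 0\<^sub>v (degree p)}"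

definition subspace_dim :: "nat \<Rightarrow> 'a::field vec set \<Rightarrow> nat" where
  "subspace_dim n W =
     vectorspace.dim (class_ring :: 'a ring) ((module_vec TYPE('a) n)\<lparr>carrier := W\<rparr>)"

definition subspace_dist :: "nat \<Rightarrow> 'a::field vec set \<Rightarrow> 'a vec set \<Rightarrow> int" where
  "subspace_dist n A B =
     int (subspace_dim n A) + int (subspace_dim n B) - 2 * int (subspace_dim n (A \<inter> B))"

definition grassmannian_code :: "nat \<Rightarrow> 'a::field vec set set \<Rightarrow> bool" where
  "grassmannian_code n C \<longleftrightarrow>
     (\<forall>W\<in>C. VectorSpace.subspace (class_ring :: 'a ring) W (module_vec TYPE('a) n)) \<and>
     (\<forall>A\<in>C. \<forall>B\<in>C. subspace_dim n A = subspace_dim n B)"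

definition min_distance :: "nat \<Rightarrow> 'a::field vec set set \<Rightarrow> int" where
  "min_distance n C = Min {subspace_dist n A B | A B. A \<in> C \<and> B \<in> C \<and> A \<noteq> B}"

definition equidistant :: "nat \<Rightarrow> 'a::field vec set set \<Rightarrow> int \<Rightarrow> bool" where
  "equidistant n C \<delta> \<longleftrightarrow> (\<forall>A\<in>C. \<forall>B\<in>C. A \<noteq> B \<longrightarrow> subspace_dist n A B = \<delta>)"

end

theory Submission
  imports Defs
begin

text \<open>
  Gauss's formula: the sum of \<open>deg p\<close> over all prime powers \<open>p ^ e\<close> dividing a monic \<open>f\<close> is the degree
  of \<open>f\<close>. Summing over the \<open>q ^ n\<close> monic \<open>f\<close> of degree \<open>n\<close>, of which \<open>q ^ (n - m)\<close> are divisible by a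
  given monic polynomial of degree \<open>m\<close>, gives \<open>n q ^ n = (\<Sum>m\<le>n. A m q ^ (n - m))\<close> with
  \<open>A m = (\<Sum>d | m. d I d)\<close>. Comparing consecutive values of \<open>n\<close> yields \<open>A n = q ^ n\<close>, to which
  Moebius inversion applies.

  Maximum: dividing by \<open>g\<close> leaves pairwise coprime polynomials of degree \<open>n = k - t\<close>. Choosing in
  each an irreducible factor of degree \<open>n\<close> or at most \<open>n div 2\<close> is injective, which gives the upper
  bound. Conversely, since the number of irreducible polynomials other than \<open>X\<close> is monotone in the
  degree, those of degree \<open>i < n / 2\<close> can be multiplied by distinct irreducible ones of degree \<open>n - i\<close>,
  while those of degree \<open>n / 2\<close> are squared and those of degree \<open>n\<close> are kept.

  Distance: a vector of length \<open>2 k\<close> is a linear functional on the polynomials of degree below \<open>2 k\<close>,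
  and \<open>ker F_P\<close> consists of the functionals vanishing on the multiples of \<open>P\<close>. By Bezout with degree
  bounds, \<open>ker F_P \<inter> ker F_Q\<close> is the space of functionals vanishing on the multiples of \<open>gcd P Q\<close>,
  and its dimension is \<open>deg (gcd P Q)\<close>, because the initial values of a recurrence are free.
\<close>

section \<open>Monic polynomials over a finite field\<close>

definition monics :: "nat \<Rightarrow> 'a::comm_ring_1 poly set" where
  "monics n = {p. lead_coeff p = 1 \<and> degree p = n}"

lemma monicsD: "p \<in> monics n \<Longrightarrow> p \<noteq> 0 \<and> lead_coeff p = 1 \<and> degree p = n"
  by (auto simp: monics_def)

lemma monics_0: "monics 0 = {1}"
  by (auto simp: monics_def elim!: degree_eq_zeroE simp: one_pCons)

text \<open>Splitting off the constant coefficient turns finiteness and the count of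
  \<open>monics n\<close> into inductions on \<open>n\<close>.\<close>

lemma monics_Suc: "monics (Suc n) = (\<lambda>(a, p). pCons a p) ` (UNIV \<times> monics n)"
proof (intro equalityI subsetI)
  fix p :: "'a poly" assume p: "p \<in> monics (Suc n)"
  obtain a r where r: "p = pCons a r" by (cases p) auto
  with p have "r \<in> monics n" by (auto simp: monics_def split: if_splits)
  with r show "p \<in> (\<lambda>(a, p). pCons a p) ` (UNIV \<times> monics n)" by auto
next
  fix p :: "'a poly" assume "p \<in> (\<lambda>(a, p). pCons a p) ` (UNIV \<times> monics n)"
  then show "p \<in> monics (Suc n)" by (auto simp: monics_def)
qed

lemma finite_monics [simp]: "finite (monics n :: 'a::{comm_ring_1,finite} poly set)"
  by (induction n) (simp_all add: monics_0 monics_Suc)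

lemma card_monics: "card (monics n :: 'a::{comm_ring_1,finite} poly set) = CARD('a) ^ n"
proof (induction n)
  case (Suc n)
  have "inj_on (\<lambda>(a, p). pCons a p) (UNIV \<times> monics n :: ('a \<times> 'a poly) set)"
    by (auto simp: inj_on_def)
  then show ?case
    using Suc by (simp add: monics_Suc card_image card_cartesian_product)
qed (simp add: monics_0)

lemma monics_mult:
  fixes p r :: "'a::idom poly"
  shows "p \<in> monics m \<Longrightarrow> r \<in> monics n \<Longrightarrow> p * r \<in> monics (m + n)"
  unfolding monics_def mem_Collect_eq lead_coeff_mult
  by (metis degree_mult_eq leading_coeff_0_iff mult_1 zero_neq_one)

lemma monics_cofactor:
  fixes p r :: "'a::idom poly"
  assumes "p \<in> monics m" "p * r \<in> monics n"
  shows "m \<le> n \<and> r \<in> monics (n - m)"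
proof -
  have "r \<noteq> 0" using monicsD[OF assms(2)] by auto
  have p: "p \<noteq> 0" "lead_coeff p = 1" "degree p = m" and pr: "lead_coeff (p * r) = 1" "degree (p * r) = n"
    using monicsD[OF assms(1)] monicsD[OF assms(2)] by blast+
  have "degree p + degree r = n" "lead_coeff r = 1"
    using degree_mult_eq[OF p(1) \<open>r \<noteq> 0\<close>] lead_coeff_mult[of p r] p pr by simp_all
  then show ?thesis
    using monicsD[OF assms(1)] by (auto simp: monics_def)
qed

lemma monics_power: "(p :: 'a::idom poly) \<in> monics m \<Longrightarrow> p ^ e \<in> monics (e * m)"
  by (induction e) (auto simp: monics_0 dest: monics_mult)

lemma card_monic_multiples:
  fixes h :: "'a::{idom,finite} poly"
  assumes h: "h \<in> monics d"
  shows "card {f \<in> monics n. h dvd f} = (if d \<le> n then CARD('a) ^ (n - d) else 0)"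
proof (cases "d \<le> n")
  case True
  have "{f \<in> monics n. h dvd f} = (*) h ` monics (n - d)"
  proof (intro equalityI subsetI)
    fix f assume "f \<in> {f \<in> monics n. h dvd f}"
    then obtain r where "f \<in> monics n" "f = h * r" by auto
    then show "f \<in> (*) h ` monics (n - d)" using monics_cofactor[OF h] by blast
  next
    fix f assume "f \<in> (*) h ` monics (n - d)"
    then show "f \<in> {f \<in> monics n. h dvd f}" using monics_mult[OF h, of _ "n - d"] True by auto
  qed
  moreover have "inj_on ((*) h) (monics (n - d))"
    using monicsD[OF h] by (auto simp: inj_on_def)
  ultimately show ?thesis using True by (simp add: card_image card_monics)
next
  case False
  then have "{f \<in> monics n. h dvd f} = {}" using monics_cofactor[OF h] by (fastforce elim!: dvdE)
  with False show ?thesis by simp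
qed

section \<open>Prime polynomials and factorization over a field\<close>

lemma normalize_poly_field:
  fixes p :: "'a::field_gcd poly"
  shows "normalize p = p \<longleftrightarrow> p = 0 \<or> lead_coeff p = 1"
proof (cases "p = 0")
  case False
  then have *: "unit_factor (lead_coeff p) = lead_coeff p"
    by (intro is_unit_unit_factor) (simp add: dvd_field_iff)
  have "normalize p = Polynomial.smult (inverse (lead_coeff p)) p"
    by (simp add: normalize_poly_eq_map_poly * poly_eq_iff coeff_map_poly field_simps)
  moreover have "Polynomial.smult (inverse (lead_coeff p)) p = p \<longleftrightarrow> lead_coeff p = 1"
  proof
    assume "Polynomial.smult (inverse (lead_coeff p)) p = p"
    then have "lead_coeff (Polynomial.smult (inverse (lead_coeff p)) p) = lead_coeff p" by simp
    then show "lead_coeff p = 1" using False by simp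
  qed simp
  ultimately show ?thesis using False by simp
qed simp

text \<open>The library's \<open>prime\<close> asks for \<open>normalize p = p\<close>, which over a
  field says that a nonzero \<open>p\<close> is monic. So the factorization lemmas for
  \<open>prime\<close> speak about monic irreducibles.\<close>

lemma prime_poly_field_iff:
  fixes p :: "'a::field_gcd poly"
  shows "prime p \<longleftrightarrow> irreducible p \<and> lead_coeff p = 1"
  by (auto simp: prime_def irreducible_imp_prime_elem prime_elem_imp_irreducible normalize_poly_field
      dest!: irreducible_imp_prime_elem)

lemma prime_degree_pos: "prime (p :: 'a::field_gcd poly) \<Longrightarrow> degree p \<ge> 1"
  by (metis One_nat_def Suc_leI gr0I is_unit_iff_degree not_prime_0 not_prime_unit)

lemma monic_irreducibles_eq: "monic_irreducibles TYPE('a::field_gcd) n = {p \<in> monics n. prime p}"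
  by (auto simp: monic_irreducibles_def monics_def prime_poly_field_iff)

lemma finite_monic_irreducibles [simp]:
  "finite (monic_irreducibles TYPE('a::{field_gcd,finite}) n)"
  by (simp add: monic_irreducibles_eq)

text \<open>Being monic, \<open>f\<close> is equal to the product of its prime powers and not merely
  associated with it; comparing degrees gives the claim.\<close>

lemma degree_eq_sum_multiplicity:
  fixes f :: "'a::field_gcd poly"
  assumes "f \<in> monics n"
  shows "n = (\<Sum>p\<in>prime_factors f. multiplicity p f * degree p)"
proof -
  have f: "f \<noteq> 0" "normalize f = f" "degree f = n"
    using monicsD[OF assms] by (auto simp: normalize_poly_field)
  then have "n = degree (\<Prod>p\<in>prime_factors f. p ^ multiplicity p f)"
    by (simp add: prod_prime_factors)
  also have "\<dots> = (\<Sum>p\<in>prime_factors f. degree (p ^ multiplicity p f))"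
    by (rule degree_prod_sum_eq) (auto simp: in_prime_factors_iff)
  also have "\<dots> = (\<Sum>p\<in>prime_factors f. multiplicity p f * degree p)"
    by (rule sum.cong) (auto simp: degree_power_eq in_prime_factors_iff)
  finally show ?thesis .
qed

section \<open>Gauss's formula\<close>

text \<open>The exponents that count are \<open>1\<close> up to the multiplicity, which is at most
  \<open>n\<close> because \<open>p\<close> has degree at least 1. Divisibility conditions replace
  the multiplicity so that they can be counted over all \<open>f\<close>.\<close>

lemma multiplicity_eq_card:
  fixes f p :: "'a::field_gcd poly"
  assumes f: "f \<in> monics n" and p: "prime p"
  shows "multiplicity p f = card {e \<in> {1..n}. p ^ e dvd f}"
proof -
  have nz: "f \<noteq> 0" "\<not> is_unit p" using monicsD[OF f] p by auto
  have "multiplicity p f \<le> n"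
  proof -
    have "degree (p ^ multiplicity p f) \<le> degree f"
      using nz p by (intro dvd_imp_degree multiplicity_dvd) auto
    then have "multiplicity p f * degree p \<le> n"
      using p monicsD[OF f] by (simp add: degree_power_eq)
    then show ?thesis
      using mult_le_mono2[OF prime_degree_pos[OF p], of "multiplicity p f"] by linarith
  qed
  then have "{e \<in> {1..n}. p ^ e dvd f} = {1..multiplicity p f}"
    using nz by (auto simp: power_dvd_iff_le_multiplicity)
  then show ?thesis by simp
qed

text \<open>All index sets on the right are independent of \<open>f\<close>, which is what allows a
  later sum over \<open>f\<close> to be moved inside.\<close>

lemma degree_eq_sum_prime_powers:
  fixes f :: "'a::{field_gcd,finite} poly"
  assumes f: "f \<in> monics n"
  shows "n = (\<Sum>d=1..n. \<Sum>p\<in>monic_irreducibles TYPE('a) d. \<Sum>e=1..n. if p ^ e dvd f then d else 0)"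
proof -
  have f0: "f \<noteq> 0" and deg: "degree f = n" using monicsD[OF f] by auto
  have sub: "prime_factors f \<subseteq> (\<Union>d\<in>{1..n}. monic_irreducibles TYPE('a) d)"
  proof
    fix p assume "p \<in> prime_factors f"
    then have p: "prime p" "p dvd f" by auto
    have "degree p \<le> n" using dvd_imp_degree[OF p(2)] p f0 deg by auto
    then show "p \<in> (\<Union>d\<in>{1..n}. monic_irreducibles TYPE('a) d)"
      using p prime_degree_pos[OF p(1)] by (auto simp: monic_irreducibles_def prime_poly_field_iff)
  qed
  have "n = (\<Sum>p\<in>prime_factors f. multiplicity p f * degree p)"
    by (rule degree_eq_sum_multiplicity[OF f])
  \<comment> \<open>The enlarged index set adds only primes not dividing \<open>f\<close>, and these
    have multiplicity 0.\<close>
  also have "\<dots> = (\<Sum>p\<in>(\<Union>d\<in>{1..n}. monic_irreducibles TYPE('a) d). multiplicity p f * degree p)"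
    using f0 by (intro sum.mono_neutral_left sub)
      (auto simp: monic_irreducibles_eq in_prime_factors_iff not_dvd_imp_multiplicity_0)
  also have "\<dots> = (\<Sum>d=1..n. \<Sum>p\<in>monic_irreducibles TYPE('a) d. multiplicity p f * degree p)"
    by (rule sum.UNION_disjoint) (simp, simp, auto simp: monic_irreducibles_def)
  also have "\<dots> = (\<Sum>d=1..n. \<Sum>p\<in>monic_irreducibles TYPE('a) d.
      \<Sum>e=1..n. if p ^ e dvd f then d else 0)"
    by (intro sum.cong refl)
      (auto simp: monic_irreducibles_eq multiplicity_eq_card[OF f] monics_def
        sum.If_cases Int_def)
  finally show ?thesis .
qed

text \<open>Groups the pairs \<open>(d, e)\<close> by their product \<open>m = e * d\<close>; for
  fixed \<open>m\<close> the divisor \<open>d\<close> determines \<open>e\<close>.\<close>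

lemma sum_by_product:
  fixes F :: "nat \<Rightarrow> nat \<Rightarrow> nat"
  shows "(\<Sum>d=1..n. \<Sum>e=1..n. if e * d \<le> n then F d (e * d) else 0)
    = (\<Sum>m=1..n. \<Sum>d | d dvd m. F d m)"
proof -
  have "(\<Sum>d=1..n. \<Sum>e=1..n. if e * d \<le> n then F d (e * d) else 0)
      = (\<Sum>(d, e)\<in>{1..n} \<times> {1..n}. if e * d \<le> n then F d (e * d) else 0)"
    by (simp add: sum.cartesian_product)
  also have "\<dots> = (\<Sum>(d, e)\<in>{(d, e) \<in> {1..n} \<times> {1..n}. e * d \<le> n}. F d (e * d))"
    by (rule sum.mono_neutral_cong_right) (auto split: if_splits)
  also have "\<dots> = (\<Sum>(m, d)\<in>(SIGMA m:{1..n}. {d. d dvd m}). F d m)"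
  proof (rule sum.reindex_bij_witness[where i = "\<lambda>(m, d). (d, m div d)" and j = "\<lambda>(d, e). (e * d, d)"])
    fix a assume "a \<in> (SIGMA m:{1..n}. {d. d dvd m})"
    then obtain d e where a: "a = (d * e, d)" "1 \<le> d * e" "d * e \<le> n" by (auto elim!: dvdE)
    then have "1 \<le> d" "1 \<le> e" by (auto simp: Suc_le_eq)
    moreover from this have "d \<le> d * e" "e \<le> d * e" by auto
    then have "d \<le> n" "e \<le> n" using a(3) by linarith+
    ultimately show "(case a of (m, d) \<Rightarrow> (d, m div d)) \<in> {(d, e) \<in> {1..n} \<times> {1..n}. e * d \<le> n}"
      and "(case (case a of (m, d) \<Rightarrow> (d, m div d)) of (d, e) \<Rightarrow> (e * d, d)) = a"
      using a by (auto simp: mult.commute)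
  qed (auto simp: Suc_le_eq)
  also have "\<dots> = (\<Sum>m=1..n. \<Sum>d | d dvd m. F d m)"
    by (rule sum.Sigma[symmetric]) auto
  finally show ?thesis .
qed

lemma prime_power_count:
  "n * CARD('a) ^ n = (\<Sum>m=1..n. (\<Sum>d | d dvd m. d * num_irreducible TYPE('a::{field_gcd,finite}) d)
      * CARD('a) ^ (n - m))"
proof -
  define q where "q = CARD('a)"
  let ?I = "monic_irreducibles TYPE('a)"
  have "n * q ^ n = (\<Sum>f\<in>(monics n :: 'a poly set). n)"
    by (simp add: card_monics q_def)
  also have "\<dots> = (\<Sum>f\<in>monics n. \<Sum>d=1..n. \<Sum>p\<in>?I d. \<Sum>e=1..n. if p ^ e dvd f then d else 0)"
    by (intro sum.cong refl degree_eq_sum_prime_powers)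
  \<comment> \<open>Moving the sum over \<open>f\<close> innermost leaves, for each fixed
    \<open>p ^ e\<close>, the number of its monic multiples of degree \<open>n\<close>.\<close>
  also have "\<dots> = (\<Sum>d=1..n. \<Sum>f\<in>monics n. \<Sum>p\<in>?I d. \<Sum>e=1..n. if p ^ e dvd f then d else 0)"
    by (rule sum.swap)
  also have "\<dots> = (\<Sum>d=1..n. \<Sum>p\<in>?I d. \<Sum>f\<in>monics n. \<Sum>e=1..n. if p ^ e dvd f then d else 0)"
    by (intro sum.cong refl sum.swap)
  also have "\<dots> = (\<Sum>d=1..n. \<Sum>p\<in>?I d. \<Sum>e=1..n. \<Sum>f\<in>monics n. if p ^ e dvd f then d else 0)"
    by (intro sum.cong refl sum.swap)
  also have "\<dots> = (\<Sum>d=1..n. \<Sum>p\<in>?I d. \<Sum>e=1..n. if e * d \<le> n then d * q ^ (n - e * d) else 0)"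
  proof (intro sum.cong refl)
    fix d e p assume "p \<in> ?I d"
    then have "p ^ e \<in> monics (e * d)" by (auto simp: monic_irreducibles_eq intro: monics_power)
    from card_monic_multiples[OF this, of n]
    show "(\<Sum>f\<in>monics n. if p ^ e dvd f then d else 0) = (if e * d \<le> n then d * q ^ (n - e * d) else 0)"
      by (simp add: sum.If_cases Int_def q_def)
  qed
  also have "\<dots> = (\<Sum>d=1..n. \<Sum>e=1..n.
      if e * d \<le> n then d * num_irreducible TYPE('a) d * q ^ (n - e * d) else 0)"
    by (intro sum.cong refl) (auto simp: num_irreducible_def sum_distrib_left intro!: sum.cong)
  also have "\<dots> = (\<Sum>m=1..n. \<Sum>d | d dvd m. d * num_irreducible TYPE('a) d * q ^ (n - m))"
    by (rule sum_by_product)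
  finally show ?thesis by (simp add: q_def sum_distrib_right)
qed

lemma sum_divisors_irreducible:
  assumes "n \<ge> 1"
  shows "(\<Sum>d | d dvd n. d * num_irreducible TYPE('a::{field_gcd,finite}) d) = CARD('a) ^ n"
proof -
  obtain m where n: "n = Suc m" using assms by (cases n) auto
  let ?A = "\<lambda>m. \<Sum>d | d dvd m. d * num_irreducible TYPE('a) d"
  \<comment> \<open>All terms but the last add up to \<open>CARD('a)\<close> times the identity for
    \<open>m\<close>, so \<open>?A (Suc m)\<close> is what remains of
    \<open>Suc m * CARD('a) ^ Suc m\<close> after removing
    \<open>m * CARD('a) ^ Suc m\<close>.\<close>
  have "Suc m * CARD('a) ^ Suc m = (\<Sum>k=1..m. ?A k * CARD('a) ^ (Suc m - k)) + ?A (Suc m)"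
    by (subst prime_power_count) simp
  also have "(\<Sum>k=1..m. ?A k * CARD('a) ^ (Suc m - k)) = CARD('a) * (m * CARD('a) ^ m)"
    by (subst prime_power_count) (auto simp: sum_distrib_left Suc_diff_le intro!: sum.cong)
  finally show ?thesis by (simp add: n)
qed

section \<open>Moebius inversion over divisors\<close>

text \<open>Only squarefree divisors contribute, and they correspond to the subsets of the prime
  factors of \<open>n\<close>. The alternating sum over subsets is the expansion of a product of
  factors \<open>1 - 1\<close>, which is nonzero only when empty.\<close>

lemma sum_moebius_divisors:
  assumes "n > 0"
  shows "(\<Sum>d | d dvd n. moebius d) = (if n = 1 then 1 else 0)"
proof -
  let ?P = "prime_factors n"
  have prod: "prime_factors (\<Prod>B) = B \<and> squarefree (\<Prod>B) \<and> \<Prod>B dvd n" if "B \<subseteq> ?P" for B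
  proof -
    have B: "finite B" "\<And>p. p \<in> B \<Longrightarrow> prime p" using that finite_subset by (auto simp: subset_iff)
    have "prime_factors (\<Prod>B) = B" using B
      by (subst prime_factors_prod) (auto simp: prime_prime_factors dest: B(2))
    moreover have "squarefree (\<Prod>B)" using B
      by (intro squarefree_prod_coprime) (auto intro: primes_coprime squarefree_prime)
    moreover have "\<Prod>B dvd n"
    proof -
      have "\<Prod>B dvd (\<Prod>p\<in>B. p ^ multiplicity p n)"
        using that by (intro prod_dvd_prod dvd_power) (auto simp: prime_factors_multiplicity)
      also have "\<dots> dvd (\<Prod>p\<in>?P. p ^ multiplicity p n)"
        using that by (intro prod_dvd_prod_subset) auto
      finally show ?thesis using prime_factorization_nat[OF assms] by simp
    qed
    ultimately show ?thesis by blast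
  qed
  have "(\<Sum>d | d dvd n. moebius d) = (\<Sum>d | d dvd n \<and> squarefree d. (- 1) ^ card (prime_factors d))"
    using assms by (intro sum.mono_neutral_cong_right) (auto simp: moebius_def)
  also have "\<dots> = (\<Sum>B\<in>Pow ?P. (- 1) ^ card B)"
  proof (rule sum.reindex_bij_witness[where i = "\<lambda>B. \<Prod>B" and j = prime_factors])
    fix d assume d: "d \<in> {d. d dvd n \<and> squarefree d}"
    then have "d > 0" using assms by (auto intro: Nat.gr0I)
    then have "d = (\<Prod>p\<in>prime_factors d. p ^ multiplicity p d)" by (rule prime_factorization_nat)
    also have "\<dots> = \<Prod>(prime_factors d)"
    proof (rule prod.cong[OF refl])
      fix p assume "p \<in> prime_factors d"
      then have "multiplicity p d = 1" using d \<open>d > 0\<close>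
        by (auto simp: squarefree_factorial_semiring')
      then show "p ^ multiplicity p d = p" by simp
    qed
    finally show "\<Prod>(prime_factors d) = d" ..
    show "prime_factors d \<in> Pow ?P" using d assms by (auto intro: dvd_prime_factors[THEN subsetD])
  qed (use prod in auto)
  also have "\<dots> = (\<Prod>p\<in>?P. 1 - 1 :: int)"
    by (subst prod_diff_conv_sum) auto
  also have "\<dots> = (if ?P = {} then 1 else 0)"
    by (simp add: power_0_left card_eq_0_iff)
  also have "?P = {} \<longleftrightarrow> n = 1" using assms by (auto simp: prime_factorization_empty_iff)
  finally show ?thesis .
qed

text \<open>Both double sums run over the pairs with \<open>d * c dvd n\<close>.\<close>

lemma divisor_pairs_swap:
  fixes G :: "nat \<Rightarrow> nat \<Rightarrow> 'b::comm_monoid_add"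
  assumes "n > 0"
  shows "(\<Sum>d | d dvd n. \<Sum>c | c dvd n div d. G d c) = (\<Sum>c | c dvd n. \<Sum>d | d dvd n div c. G d c)"
proof -
  have fin: "finite {d. d dvd n}" "\<And>d. d \<in> {d. d dvd n} \<Longrightarrow> finite {c. c dvd n div d}"
    using assms by (auto intro!: finite_divisors_nat Nat.gr0I elim!: dvdE)
  have *: "(d dvd n \<and> c dvd n div d) \<longleftrightarrow> d * c dvd n" for c d
  proof (cases "d dvd n")
    case True
    then show ?thesis using assms by (subst dvd_div_iff_mult) (auto simp: mult.commute)
  qed (use dvd_mult_left in blast)
  have S: "(SIGMA d:{d. d dvd n}. {c. c dvd n div d}) = {(d, c). d * c dvd n}"
    unfolding *[symmetric] by auto
  have "(\<Sum>(d, c)\<in>{(d, c). d * c dvd n}. G d c) = (\<Sum>(c, d)\<in>{(c, d). c * d dvd n}. G d c)"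
    by (rule sum.reindex_bij_witness[where i = prod.swap and j = prod.swap])
      (auto simp: mult.commute)
  then show ?thesis
    using fin by (simp add: sum.Sigma S)
qed

text \<open>Expanding each power of \<open>CARD('a)\<close> by
  \<open>sum_divisors_irreducible\<close> and exchanging the sums leaves an inner Moebius sum over
  the divisors of \<open>n div c\<close>, which vanishes unless \<open>c = n\<close>.\<close>

lemma gauss_formula:
  assumes "n \<ge> 1"
  shows "(of_nat (num_irreducible TYPE('a::{field_gcd,finite}) n) :: rat)
    = 1 / of_nat n * (\<Sum>d | d dvd n. of_int (moebius d) * of_nat (CARD('a)) ^ (n div d))"
proof -
  let ?N = "num_irreducible TYPE('a)"
  have pos: "n div d \<ge> 1" if "d dvd n" for d
    using that assms by (auto simp: Suc_le_eq div_greater_zero_iff dest: dvd_imp_le)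
  have "(\<Sum>d | d dvd n. moebius d * int (CARD('a)) ^ (n div d))
      = (\<Sum>d | d dvd n. \<Sum>c | c dvd n div d. moebius d * int (c * ?N c))"
  proof (intro sum.cong refl)
    fix d assume "d \<in> {d. d dvd n}"
    then have "int (CARD('a) ^ (n div d)) = int (\<Sum>c | c dvd n div d. c * ?N c)"
      using pos sum_divisors_irreducible[of "n div d", where 'a='a] by simp
    then show "moebius d * int (CARD('a)) ^ (n div d) = (\<Sum>c | c dvd n div d. moebius d * int (c * ?N c))"
      by (simp add: sum_distrib_left)
  qed
  also have "\<dots> = (\<Sum>c | c dvd n. \<Sum>d | d dvd n div c. moebius d * int (c * ?N c))"
    using assms by (intro divisor_pairs_swap) auto
  also have "\<dots> = (\<Sum>c | c dvd n. if c = n then int (c * ?N c) else 0)"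
  proof (intro sum.cong refl)
    fix c assume c: "c \<in> {c. c dvd n}"
    then have "n div c = 1 \<longleftrightarrow> c = n" using assms by (auto elim!: dvdE)
    then show "(\<Sum>d | d dvd n div c. moebius d * int (c * ?N c)) = (if c = n then int (c * ?N c) else 0)"
      using sum_moebius_divisors[of "n div c"] pos[of c] c by (simp flip: sum_distrib_right)
  qed
  also have "\<dots> = int (n * ?N n)" using assms by (simp add: sum.delta)
  finally have "of_int (\<Sum>d | d dvd n. moebius d * int (CARD('a)) ^ (n div d)) = (of_int (int (n * ?N n)) :: rat)"
    by simp
  then show ?thesis using assms by (simp add: field_simps)
qed

section \<open>Growth of the number of irreducible polynomials\<close>

definition nz_irreducibles :: "nat \<Rightarrow> 'a::field_gcd poly set" where
  "nz_irreducibles n = {p \<in> monics n. prime p \<and> poly p 0 \<noteq> 0}"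

lemma num_irreducible_nz_eq:
  "num_irreducible_nz TYPE('a::field_gcd) n = card (nz_irreducibles n :: 'a poly set)"
  unfolding num_irreducible_nz_def nz_irreducibles_def monic_irreducibles_eq
  by (rule arg_cong[of _ _ card]) auto

lemma finite_nz_irreducibles [simp]: "finite (nz_irreducibles n :: 'a::{field_gcd,finite} poly set)"
  by (simp add: nz_irreducibles_def)

lemma prime_X: "prime [:0, 1 :: 'a::field_gcd:]"
  by (simp add: prime_poly_field_iff irreducible_linear_field_poly)

text \<open>A prime with root 0 is divisible by the prime X and therefore equal to it.\<close>

lemma num_irreducible_eq_nz:
  "num_irreducible TYPE('a::{field_gcd,finite}) n
    = num_irreducible_nz TYPE('a) n + (if n = 1 then 1 else 0)"
proof -
  have X: "p = [:0, 1:]" if "prime p" "poly p 0 = 0" for p :: "'a poly"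
  proof -
    have "[:0, 1:] dvd p" using that(2) by (simp add: poly_eq_0_iff_dvd)
    then show ?thesis using primes_dvd_imp_eq[OF prime_X that(1)] by simp
  qed
  have "monic_irreducibles TYPE('a) n = nz_irreducibles n \<union> (if n = 1 then {[:0, 1:]} else {})"
    using prime_X[where 'a='a]
    by (auto simp: monic_irreducibles_eq nz_irreducibles_def monics_def dest: X)
  moreover have "[:0, 1 :: 'a:] \<notin> nz_irreducibles m" for m by (simp add: nz_irreducibles_def)
  ultimately show ?thesis
    by (simp add: num_irreducible_def num_irreducible_nz_eq card_insert_if)
qed

lemma card_field_ge_2: "CARD('a::{field,finite}) \<ge> 2"
proof -
  have "card {0, 1 :: 'a} \<le> CARD('a)" by (rule card_mono) auto
  then show ?thesis by simp
qed

lemma degree_mult_num_irreducible_le: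
  assumes "n \<ge> 1"
  shows "n * num_irreducible TYPE('a::{field_gcd,finite}) n \<le> CARD('a) ^ n"
proof -
  have "n * num_irreducible TYPE('a) n \<le> (\<Sum>d | d dvd n. d * num_irreducible TYPE('a) d)"
    using assms by (intro member_le_sum) auto
  then show ?thesis by (simp add: sum_divisors_irreducible[OF assms])
qed

lemma geometric_sum_le:
  fixes q :: nat
  assumes "q \<ge> 2"
  shows "(\<Sum>d=1..m. q ^ d) + q \<le> q ^ Suc m"
proof (induction m)
  case (Suc m)
  have "(\<Sum>d=1..Suc m. q ^ d) + q \<le> 2 * q ^ Suc m" using Suc by simp
  also have "\<dots> \<le> q * q ^ Suc m" using assms by (intro mult_le_mono1)
  finally show ?case by simp
qed simp

text \<open>Proper divisors of \<open>n\<close> are at most \<open>n div 2\<close>, so their part of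
  the divisor sum is bounded by a geometric sum.\<close>

lemma degree_mult_num_irreducible_ge:
  assumes "n \<ge> 1"
  shows "CARD('a) ^ n \<le> n * num_irreducible TYPE('a::{field_gcd,finite}) n + CARD('a) ^ Suc (n div 2)"
proof -
  have sub: "{d. d dvd n} - {n} \<subseteq> {1..n div 2}"
  proof
    fix d assume d: "d \<in> {d. d dvd n} - {n}"
    then obtain e where e: "n = d * e" by auto
    with d assms have "e \<ge> 2" "d \<ge> 1" by (cases e; cases "e - 1"; auto)+
    then have "2 * d \<le> n" using e by (metis mult.commute mult_le_mono2)
    then show "d \<in> {1..n div 2}" using \<open>d \<ge> 1\<close> by auto
  qed
  have "CARD('a) ^ n = n * num_irreducible TYPE('a) n
      + (\<Sum>d\<in>{d. d dvd n} - {n}. d * num_irreducible TYPE('a) d)"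
    using assms by (subst sum_divisors_irreducible[symmetric, OF assms])
      (rule sum.remove, auto)
  also have "(\<Sum>d\<in>{d. d dvd n} - {n}. d * num_irreducible TYPE('a) d) \<le> (\<Sum>d=1..n div 2. CARD('a) ^ d)"
    using sub by (intro sum_le_included[where i = id])
      (auto intro!: degree_mult_num_irreducible_le finite_subset[OF sub])
  also have "\<dots> \<le> CARD('a) ^ Suc (n div 2)"
    using geometric_sum_le[OF card_field_ge_2[where 'a='a], of "n div 2"] by simp
  finally show ?thesis by simp
qed

text \<open>Compares the upper bound in degree \<open>n\<close> with the lower bound in degree
  \<open>Suc n\<close>. From \<open>n = 4\<close> on, the error exponent
  \<open>Suc (Suc n div 2)\<close> is at most \<open>n - 1\<close>, so the error is at most
  \<open>r\<close>.\<close>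

lemma num_irreducible_mono_large:
  assumes n: "n \<ge> 4"
  shows "num_irreducible TYPE('a::{field_gcd,finite}) n \<le> num_irreducible TYPE('a) (Suc n)"
proof -
  define q where "q = CARD('a)"
  define r where "r = q ^ (n - 1)"
  have q: "q \<ge> 2" by (simp add: q_def card_field_ge_2)
  have qn: "q ^ n = q * r" using n by (cases n) (auto simp: r_def)
  have "Suc (Suc n div 2) \<le> n - 1" using n by presburger
  then have "q ^ Suc (Suc n div 2) \<le> r" unfolding r_def using q by (intro power_increasing) auto
  then have lower: "q * (q * r) \<le> Suc n * num_irreducible TYPE('a) (Suc n) + r"
    using degree_mult_num_irreducible_ge[of "Suc n", where 'a='a] qn by (simp add: q_def[symmetric])
  have upper: "n * num_irreducible TYPE('a) n \<le> q * r"
    using degree_mult_num_irreducible_le[of n, where 'a='a] n by (simp add: q_def[symmetric] qn)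
  \<comment> \<open>Prepares the absorption of the error term \<open>n * r\<close>: one factor 2 is
    bounded by \<open>q\<close> here, and another one after \<open>1\<close>.\<close>
  have "n * r \<le> ((n - 1) * 2) * r" using n by (intro mult_le_mono1) linarith
  also have "\<dots> = (n - 1) * (2 * r)" by simp
  also have "\<dots> \<le> (n - 1) * (q * r)" using q by simp
  finally have 1: "Suc n * (q * r) + n * r \<le> n * (2 * (q * r))"
    using n by (cases n) (simp_all add: algebra_simps)
  have "Suc n * (n * num_irreducible TYPE('a) n) + n * r \<le> Suc n * (q * r) + n * r"
    using upper by (intro add_right_mono mult_le_mono2)
  also note 1
  also have "n * (2 * (q * r)) \<le> n * (q * (q * r))" using q by simp
  also have "\<dots> \<le> n * (Suc n * num_irreducible TYPE('a) (Suc n) + r)"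
    by (intro mult_le_mono2 lower)
  finally have "(Suc n * n) * num_irreducible TYPE('a) n \<le> (Suc n * n) * num_irreducible TYPE('a) (Suc n)"
    by (simp add: algebra_simps)
  then show ?thesis using n by simp
qed

text \<open>The divisor sums give closed forms in \<open>q\<close>, and the differences, cleared of
  denominators, factor into terms that are nonnegative for \<open>q \<ge> 2\<close>. The
  \<open>Suc\<close> in the first inequality is needed for \<open>q = 2\<close>, where the counts
  are 2 and 1.\<close>

lemma num_irreducible_mono_small:
  fixes I :: "nat \<Rightarrow> nat"
  defines "I \<equiv> num_irreducible TYPE('a::{field_gcd,finite})"
  shows "I 1 \<le> Suc (I 2)" "I 2 \<le> I 3" "I 3 \<le> I 4"
proof -
  define q where "q = int (CARD('a))"
  have q: "q \<ge> 2" using card_field_ge_2[where 'a='a] by (simp add: q_def)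
  have D: "{d::nat. d dvd 2} = {1, 2}" "{d::nat. d dvd 3} = {1, 3}" "{d::nat. d dvd 4} = {1, 2, 4}"
  proof -
    have *: "(d dvd 2 \<longleftrightarrow> d = 1 \<or> d = 2) \<and> (d dvd 3 \<longleftrightarrow> d = 1 \<or> d = 3)
        \<and> (d dvd 4 \<longleftrightarrow> d = 1 \<or> d = 2 \<or> d = 4)" for d :: nat
    proof (cases "d \<le> 4")
      case True
      then have "d = 0 \<or> d = 1 \<or> d = 2 \<or> d = 3 \<or> d = 4" by linarith
      then show ?thesis by (elim disjE) simp_all
    qed (auto dest: dvd_imp_le)
    show "{d::nat. d dvd 2} = {1, 2}" "{d::nat. d dvd 3} = {1, 3}" "{d::nat. d dvd 4} = {1, 2, 4}"
      using * by blast+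
  qed
  have S: "int (\<Sum>d | d dvd n. d * I d) = q ^ n" if "n \<ge> 1" for n
    using sum_divisors_irreducible[OF that, where 'a='a] by (simp add: I_def q_def)
  have I1: "int (I 1) = q" using S[of 1] by simp
  have I2: "2 * int (I 2) = q^2 - q" using S[of 2] I1 by (simp add: D)
  have I3: "3 * int (I 3) = q^3 - q" using S[of 3] I1 by (simp add: D)
  have I4: "4 * int (I 4) = q^4 - q^2" using S[of 4] I1 I2 by (simp add: D)
  have "0 \<le> (q - 1) * (q - 2)" using q by simp
  then show "I 1 \<le> Suc (I 2)" using I1 I2 by (simp add: algebra_simps power2_eq_square)
  have "0 \<le> q * ((2 * q - 1) * (q - 1))" using q by simp
  also have "\<dots> = 2 * (q^3 - q) - 3 * (q^2 - q)" by (simp add: algebra_simps power2_eq_square power3_eq_cube)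
  also have "\<dots> = 6 * int (I 3) - 6 * int (I 2)" by (simp flip: I2 I3)
  finally show "I 2 \<le> I 3" by simp
  have "0 \<le> q * ((q - 1) * ((q + 1) * (3 * q - 4)))" using q by simp
  also have "\<dots> = 3 * (q^4 - q^2) - 4 * (q^3 - q)"
    by (simp add: algebra_simps power2_eq_square power3_eq_cube power4_eq_xxxx)
  also have "\<dots> = 12 * int (I 4) - 12 * int (I 3)" by (simp flip: I3 I4)
  finally show "I 3 \<le> I 4" by simp
qed

text \<open>Discarding X lowers only the count in degree 1, which makes up for the
  \<open>Suc\<close> in the comparison of degrees 1 and 2.\<close>

lemma num_irreducible_nz_mono:
  assumes "1 \<le> i" "i \<le> j"
  shows "num_irreducible_nz TYPE('a::{field_gcd,finite}) i \<le> num_irreducible_nz TYPE('a) j"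
proof -
  have step: "num_irreducible_nz TYPE('a) n \<le> num_irreducible_nz TYPE('a) (Suc n)" if "1 \<le> n" for n
  proof -
    consider "n = 1" | "n = 2" | "n = 3" | "n \<ge> 4" using \<open>1 \<le> n\<close> by linarith
    then show ?thesis
      using num_irreducible_mono_small[where 'a='a] num_irreducible_mono_large[of n, where 'a='a]
      by cases (simp_all add: num_irreducible_eq_nz numeral_2_eq_2 numeral_3_eq_3 eval_nat_numeral)
  qed
  show ?thesis using assms(2,1) by (induction rule: dec_induct) (auto intro: order_trans[OF _ step])
qed

text \<open>In degree 1 the count is \<open>CARD('a) - 1\<close>. Positivity later covers families
  with at most one member.\<close>

lemma num_irreducible_nz_pos:
  assumes "n \<ge> 1"
  shows "num_irreducible_nz TYPE('a::{field_gcd,finite}) n \<ge> 1"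
proof -
  have "num_irreducible TYPE('a) 1 = CARD('a)" using sum_divisors_irreducible[of 1, where 'a='a] by simp
  then have "num_irreducible_nz TYPE('a) 1 \<ge> 1"
    using card_field_ge_2[where 'a='a] num_irreducible_eq_nz[of 1, where 'a='a] by simp
  then show ?thesis using num_irreducible_nz_mono[of 1 n, where 'a='a] assms by simp
qed

section \<open>Coprime families\<close>

text \<open>The pool from which each member of a coprime family receives a private prime divisor;
  its size turns out to be the maximum.\<close>

definition small_or_full :: "nat \<Rightarrow> 'a::field_gcd poly set" where
  "small_or_full n = (\<Union>i\<in>insert n {1..n div 2}. nz_irreducibles i)"

lemma small_or_full_iff:
  "p \<in> small_or_full n \<longleftrightarrow>
    prime p \<and> poly p 0 \<noteq> 0 \<and> (degree p = n \<or> 2 * degree p \<le> n)"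
  using prime_degree_pos[of p] prime_poly_field_iff[of p]
  by (cases "prime p") (auto simp: small_or_full_def nz_irreducibles_def monics_def)

lemma finite_small_or_full [simp]: "finite (small_or_full n :: 'a::{field_gcd,finite} poly set)"
  by (simp add: small_or_full_def)

lemma card_small_or_full:
  assumes "n \<ge> 1"
  shows "card (small_or_full n :: 'a::{field_gcd,finite} poly set)
    = num_irreducible_nz TYPE('a) n + (\<Sum>i=1..n div 2. num_irreducible_nz TYPE('a) i)"
proof -
  have "card (small_or_full n :: 'a poly set)
      = (\<Sum>i\<in>insert n {1..n div 2}. card (nz_irreducibles i :: 'a poly set))"
    unfolding small_or_full_def
    by (rule card_UN_disjoint) (simp, simp, auto simp: nz_irreducibles_def monics_def)
  then show ?thesis using assms by (simp add: num_irreducible_nz_eq)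
qed

text \<open>If \<open>f\<close> is reducible, the nonunit factor of smaller degree has degree at
  most \<open>n div 2\<close>, and so has any prime dividing it. Divisors of \<open>f\<close>
  inherit the nonzero constant term.\<close>

lemma small_factor_exists:
  fixes f :: "'a::field_gcd poly"
  assumes f: "f \<in> monics n" and n: "n \<ge> 1" and nz: "poly f 0 \<noteq> 0"
  shows "\<exists>p\<in>small_or_full n. p dvd f"
proof -
  have f0: "f \<noteq> 0" and deg: "degree f = n" using monicsD[OF f] by auto
  then have "\<not> is_unit f" using n by (auto simp: is_unit_iff_degree)
  have nz': "poly p 0 \<noteq> 0" if "p dvd f" for p using that nz by (auto elim!: dvdE)
  show ?thesis
  proof (cases "irreducible f")
    case True
    then show ?thesis using monicsD[OF f] nz
      by (intro bexI[of _ f]) (auto simp: small_or_full_iff prime_poly_field_iff)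
  next
    case False
    then obtain a b where ab: "f = a * b" "\<not> is_unit a" "\<not> is_unit b"
      using f0 \<open>\<not> is_unit f\<close> by (auto simp: irreducible_def)
    have "degree a + degree b = n" using ab(1) f0 deg by (auto simp: degree_mult_eq)
    then have "\<exists>c. c dvd f \<and> \<not> is_unit c \<and> 2 * degree c \<le> n"
      using ab by (cases "degree a \<le> degree b") (auto intro: exI[of _ a] exI[of _ b])
    then obtain c where c: "c dvd f" "\<not> is_unit c" "2 * degree c \<le> n" by blast
    have "c \<noteq> 0" using c(1) f0 by auto
    obtain p where p: "p dvd c" "prime p" using prime_divisor_exists[OF \<open>c \<noteq> 0\<close> c(2)] by blast
    have "degree p \<le> degree c" using p \<open>c \<noteq> 0\<close> by (intro dvd_imp_degree) auto
    then show ?thesis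
      using p c nz'[of p] dvd_trans[OF p(1) c(1)] by (auto simp: small_or_full_iff)
  qed
qed

text \<open>Coprime polynomials share no prime divisor, so any choice of a prime divisor from the
  pool is injective.\<close>

lemma card_coprime_le:
  fixes T :: "'a::{field_gcd,finite} poly set"
  assumes T: "T \<subseteq> {f \<in> monics n. poly f 0 \<noteq> 0}" and n: "n \<ge> 1" and cop: "pairwise coprime T"
  shows "card T \<le> card (small_or_full n :: 'a poly set)"
proof -
  have "\<forall>f\<in>T. \<exists>p. p \<in> small_or_full n \<and> p dvd f"
    using T small_factor_exists n by blast
  then obtain \<phi> where \<phi>: "\<And>f. f \<in> T \<Longrightarrow> \<phi> f \<in> small_or_full n \<and> \<phi> f dvd f"
    using bchoice by metis
  have "inj_on \<phi> T"
  proof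
    fix f h assume fh: "f \<in> T" "h \<in> T" "\<phi> f = \<phi> h"
    then have "\<phi> f dvd f" "\<phi> f dvd h" "\<not> is_unit (\<phi> f)" using \<phi>[of f] \<phi>[of h]
      by (auto simp: small_or_full_iff)
    then have "\<not> coprime f h" using coprime_common_divisor by blast
    then show "f = h" using cop fh by (auto simp: pairwise_def)
  qed
  then show ?thesis using \<phi> by (intro card_inj_on_le[of \<phi>]) auto
qed

text \<open>The cofactor \<open>c p\<close> fills \<open>p\<close> up to degree \<open>n\<close>: it
  is \<open>1\<close> in degree \<open>n\<close>, \<open>p\<close> itself in degree
  \<open>n / 2\<close>, and otherwise a prime of degree \<open>n - degree p\<close>. Monotonicity of
  the counts lets the last kind be chosen injectively in each degree.\<close>

lemma exists_cofactor:
  assumes n: "n \<ge> 1"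
  obtains c :: "'a::{field_gcd,finite} poly \<Rightarrow> 'a poly" where
    "\<And>p. p \<in> small_or_full n \<Longrightarrow> p * c p \<in> monics n \<and> poly (c p) 0 \<noteq> 0"
    "\<And>p. p \<in> small_or_full n \<Longrightarrow>
      c p = 1 \<or> c p = p \<or> prime (c p) \<and> n < 2 * degree (c p) \<and> degree (c p) < n"
    "\<And>p r. p \<in> small_or_full n \<Longrightarrow> r \<in> small_or_full n \<Longrightarrow> c p = c r \<Longrightarrow> n < 2 * degree (c p) \<Longrightarrow> p = r"
proof -
  have "\<exists>\<phi> :: 'a poly \<Rightarrow> 'a poly. \<phi> ` nz_irreducibles i \<subseteq> nz_irreducibles (n - i) \<and>
      inj_on \<phi> (nz_irreducibles i)" if "1 \<le> i \<and> 2 * i < n" for i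
  proof -
    have "i \<le> n - i" using that by linarith
    then have "card (nz_irreducibles i :: 'a poly set) \<le> card (nz_irreducibles (n - i) :: 'a poly set)"
      using num_irreducible_nz_mono[of i "n - i", where 'a='a] that by (simp add: num_irreducible_nz_eq)
    from card_le_inj[OF _ _ this] show ?thesis by auto
  qed
  then have *: "\<forall>i. \<exists>\<phi> :: 'a poly \<Rightarrow> 'a poly. 1 \<le> i \<and> 2 * i < n \<longrightarrow> \<phi> ` nz_irreducibles i \<subseteq> nz_irreducibles (n - i) \<and>
      inj_on \<phi> (nz_irreducibles i)" by blast
  then obtain \<phi> :: "nat \<Rightarrow> 'a poly \<Rightarrow> 'a poly"
    where "\<forall>i. 1 \<le> i \<and> 2 * i < n \<longrightarrow> \<phi> i ` nz_irreducibles i \<subseteq> nz_irreducibles (n - i) \<and>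
      inj_on (\<phi> i) (nz_irreducibles i)" using choice[OF *] by blast
  then have \<phi>: "\<And>i. 1 \<le> i \<and> 2 * i < n \<Longrightarrow> \<phi> i ` nz_irreducibles i \<subseteq> nz_irreducibles (n - i)"
      "\<And>i. 1 \<le> i \<and> 2 * i < n \<Longrightarrow> inj_on (\<phi> i) (nz_irreducibles i)" by blast+
  define c where "c p = (if degree p = n then 1 else if 2 * degree p = n then p else \<phi> (degree p) p)"
    for p :: "'a poly"
  have mem: "p \<in> nz_irreducibles (degree p)" if "p \<in> small_or_full n" for p :: "'a poly"
    using that by (auto simp: small_or_full_iff nz_irreducibles_def monics_def prime_poly_field_iff)
  have c_phi: "c p \<in> nz_irreducibles (n - degree p)"
    if "p \<in> small_or_full n" "2 * degree p < n" for p
    using that mem[OF that(1)] \<phi>(1)[of "degree p"] prime_degree_pos[of p]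
    by (auto simp: c_def small_or_full_iff)
  have cases: "degree p = n \<or> 2 * degree p = n \<or> 2 * degree p < n" if "p \<in> small_or_full n" for p :: "'a poly"
    using that by (auto simp: small_or_full_iff)
  show thesis
  proof
    fix p :: "'a poly" assume p: "p \<in> small_or_full n"
    then have pm: "p \<in> monics (degree p)" "poly p 0 \<noteq> 0" "degree p \<ge> 1"
      using mem prime_degree_pos by (auto simp: nz_irreducibles_def)
    show "p * c p \<in> monics n \<and> poly (c p) 0 \<noteq> 0"
      using cases[OF p]
    proof (elim disjE)
      assume "2 * degree p < n"
      with c_phi[OF p] monics_mult[OF pm(1), of "c p" "n - degree p"] show ?thesis
        by (auto simp: nz_irreducibles_def)
    qed (use pm monics_mult[OF pm(1) pm(1)] in \<open>auto simp: c_def mult_2\<close>)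
    show "c p = 1 \<or> c p = p \<or> prime (c p) \<and> n < 2 * degree (c p) \<and> degree (c p) < n"
      using cases[OF p]
    proof (elim disjE)
      assume "2 * degree p < n"
      with c_phi[OF p] pm show ?thesis by (auto simp: nz_irreducibles_def monics_def)
    qed (auto simp: c_def)
  next
    fix p r :: "'a poly"
    assume p: "p \<in> small_or_full n" and r: "r \<in> small_or_full n" and eq: "c p = c r"
      and big: "n < 2 * degree (c p)"
    \<comment> \<open>A cofactor of degree above \<open>n / 2\<close> is neither \<open>1\<close>
      nor \<open>s\<close> with \<open>2 * degree s = n\<close>, so it comes from the injections
      \<open>\<phi>\<close>.\<close>
    have lt: "2 * degree s < n \<and> degree s \<ge> 1 \<and> degree (c s) = n - degree s"
      if "s \<in> small_or_full n" "n < 2 * degree (c s)" for s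
      using cases[OF that(1)]
    proof (elim disjE)
      assume "2 * degree s < n"
      with c_phi[OF that(1)] that(1) prime_degree_pos[of s] show ?thesis
        by (auto simp: nz_irreducibles_def monics_def small_or_full_iff)
    qed (use that n in \<open>auto simp: c_def\<close>)
    have "degree p = degree r" using lt[OF p] lt[OF r] big eq by auto
    moreover have "\<phi> (degree p) p = \<phi> (degree r) r"
      using lt[OF p] lt[OF r] big eq by (auto simp: c_def split: if_splits)
    ultimately show "p = r"
      using \<phi>(2)[of "degree p"] lt[OF p big] mem[OF p] mem[OF r] by (auto simp: inj_on_def)
  qed
qed

text \<open>The products \<open>p * c p\<close> work. Any prime in them other than \<open>p\<close>
  has degree strictly between \<open>n / 2\<close> and \<open>n\<close>, a range that the pool
  avoids, so a cofactor never collides with a pool element, and large cofactors do not collide with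
  each other.\<close>

lemma exists_coprime_family:
  assumes n: "n \<ge> 1"
  obtains T :: "'a::{field_gcd,finite} poly set" where
    "T \<subseteq> {f \<in> monics n. poly f 0 \<noteq> 0}" "pairwise coprime T"
    "card T = card (small_or_full n :: 'a poly set)"
proof -
  obtain c :: "'a poly \<Rightarrow> 'a poly" where
    c1: "\<And>p. p \<in> small_or_full n \<Longrightarrow> p * c p \<in> monics n \<and> poly (c p) 0 \<noteq> 0" and
    c2: "\<And>p. p \<in> small_or_full n \<Longrightarrow>
      c p = 1 \<or> c p = p \<or> prime (c p) \<and> n < 2 * degree (c p) \<and> degree (c p) < n" and
    c3: "\<And>p r. p \<in> small_or_full n \<Longrightarrow> r \<in> small_or_full n \<Longrightarrow> c p = c r \<Longrightarrow> n < 2 * degree (c p) \<Longrightarrow> p = r"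
    using exists_cofactor[OF n] by blast
  have prime: "prime p" "degree p = n \<or> 2 * degree p \<le> n" if "p \<in> small_or_full n" for p :: "'a poly"
    using that by (auto simp: small_or_full_iff)
  have factor: "s = p \<or> s = c p \<and> n < 2 * degree s \<and> degree s < n"
    if p: "p \<in> small_or_full n" and s: "prime s" "s dvd p * c p" for p s
  proof -
    have "s dvd p \<or> s dvd c p" using s by (simp add: prime_dvd_mult_iff)
    then show ?thesis
      using c2[OF p] s(1) prime(1)[OF p] by (auto dest: primes_dvd_imp_eq)
  qed
  have cop: "coprime (p * c p) (r * c r)"
    if p: "p \<in> small_or_full n" and r: "r \<in> small_or_full n" and "p \<noteq> r" for p r
  proof (rule ccontr)
    assume "\<not> coprime (p * c p) (r * c r)"
    then obtain d where d: "d dvd p * c p" "d dvd r * c r" "\<not> is_unit d" by (rule not_coprimeE)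
    have "d \<noteq> 0" using d(1) monicsD[of "p * c p" n] c1[OF p] by auto
    then obtain s where s: "prime s" "s dvd d" using prime_divisor_exists d(3) by blast
    have "s = p \<or> s = c p \<and> n < 2 * degree s \<and> degree s < n"
         "s = r \<or> s = c r \<and> n < 2 * degree s \<and> degree s < n"
      using factor p r s d dvd_trans by blast+
    then show False using \<open>p \<noteq> r\<close> prime(2)[OF p] prime(2)[OF r] c3[OF p r] by auto
  qed
  \<comment> \<open>Rules out that distinct \<open>p\<close> give the same product, since that
    product would be coprime to itself.\<close>
  have nonunit: "\<not> is_unit (p * c p)" if "p \<in> small_or_full n" for p
    using prime(1)[OF that] by (auto simp: is_unit_mult_iff)
  show thesis
  proof
    show "(\<lambda>p. p * c p) ` small_or_full n \<subseteq> {f \<in> monics n. poly f 0 \<noteq> 0}"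
      using c1 by (auto simp: small_or_full_iff)
    show "pairwise coprime ((\<lambda>p. p * c p) ` small_or_full n)"
      unfolding pairwise_def using cop by blast
    have "inj_on (\<lambda>p. p * c p) (small_or_full n)"
    proof
      fix p r assume "p \<in> small_or_full n" "r \<in> small_or_full n" "p * c p = r * c r"
      then show "p = r" using cop[of p r] nonunit[of p] by (metis coprime_self)
    qed
    then show "card ((\<lambda>p. p * c p) ` small_or_full n) = card (small_or_full n :: 'a poly set)"
      by (rule card_image)
  qed
qed

section \<open>From coprime families to families with prescribed gcd\<close>

lemma gcd_monic_multiples:
  fixes g :: "'a::field_gcd poly"
  assumes "lead_coeff g = 1"
  shows "gcd (g * a) (g * b) = g \<longleftrightarrow> coprime a b"
proof -
  have g: "g \<noteq> 0" "normalize g = g" using assms by (auto simp: normalize_poly_field)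
  then have "gcd (g * a) (g * b) = g * gcd a b" by (simp add: gcd_mult_left normalize_mult)
  then show ?thesis using g by (simp add: coprime_iff_gcd_eq_1)
qed

lemma CF_eq:
  "CF k g = {S. S \<subseteq> {p \<in> monics k. poly p 0 \<noteq> 0} \<and> pairwise (\<lambda>f h. gcd f h = g) S}"
  by (auto simp: CF_def monics_def)

lemma Max_card_CF:
  fixes g :: "'a::{field_gcd,finite} poly"
  assumes t: "t < k" and g: "g \<in> monics t" "poly g 0 \<noteq> 0"
  shows "Max (card ` CF k g) = card (small_or_full (k - t) :: 'a poly set)"
proof (rule Max_eqI)
  have "CF k g \<subseteq> Pow (monics k)" by (auto simp: CF_eq)
  then have "finite (CF k g)" by (rule finite_subset) simp
  then show "finite (card ` CF k g)" by (rule finite_imageI)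
next
  fix m assume "m \<in> card ` CF k g"
  then obtain S where S: "S \<in> CF k g" and m: "m = card S" by blast
  have S': "S \<subseteq> {p \<in> monics k. poly p 0 \<noteq> 0}" and pw: "pairwise (\<lambda>f h. gcd f h = g) S"
    using S by (auto simp: CF_eq)
  show "m \<le> card (small_or_full (k - t) :: 'a poly set)"
  \<comment> \<open>A single member need not be divisible by \<open>g\<close>, so division by
    \<open>g\<close> is reserved for larger families; here a positive bound suffices.\<close>
  proof (cases "card S \<le> 1")
    case True
    then show ?thesis
      using num_irreducible_nz_pos[of "k - t", where 'a='a] card_small_or_full[of "k - t", where 'a='a] t m
      by linarith
  next
    case False
    have dvd: "g dvd f" if "f \<in> S" for f
    proof -
      have "S \<noteq> {f}" using False by auto
      then obtain h where "h \<in> S" "h \<noteq> f" using \<open>f \<in> S\<close> by blast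
      then have "gcd f h = g" using pw \<open>f \<in> S\<close> by (auto simp: pairwise_def)
      then show ?thesis using gcd_dvd1[of f h] by simp
    qed
    define T where "T = {r. g * r \<in> S}"
    have ST: "S = (*) g ` T" using dvd unfolding T_def dvd_def image_def by blast
    have g0: "g \<noteq> 0" using monicsD[OF g(1)] by simp
    then have inj: "inj_on ((*) g) T" by (auto simp: inj_on_def)
    have "T \<subseteq> {f \<in> monics (k - t). poly f 0 \<noteq> 0}"
      using S' monics_cofactor[OF g(1)] by (auto simp: T_def subset_iff)
    moreover have "pairwise coprime T"
      unfolding pairwise_def
    proof (intro ballI impI)
      fix a b assume "a \<in> T" "b \<in> T" "a \<noteq> b"
      then have "gcd (g * a) (g * b) = g" using pw g0 by (auto simp: T_def pairwise_def)
      then show "coprime a b" using monicsD[OF g(1)] gcd_monic_multiples[of g a b] by blast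
    qed
    ultimately have "card T \<le> card (small_or_full (k - t) :: 'a poly set)"
      using t by (intro card_coprime_le) auto
    then show ?thesis using inj by (simp add: m ST card_image)
  qed
next
  obtain T :: "'a poly set" where T: "T \<subseteq> {f \<in> monics (k - t). poly f 0 \<noteq> 0}" "pairwise coprime T"
    "card T = card (small_or_full (k - t) :: 'a poly set)"
  proof (rule exists_coprime_family)
    show "1 \<le> k - t" using t by simp
  qed
  have g0: "g \<noteq> 0" "lead_coeff g = 1" using monicsD[OF g(1)] by auto
  have "(*) g ` T \<subseteq> {f \<in> monics k. poly f 0 \<noteq> 0}"
    using T(1) monics_mult[OF g(1), of _ "k - t"] t g(2) by auto
  moreover have "pairwise (\<lambda>f h. gcd f h = g) ((*) g ` T)"
    unfolding pairwise_def
  proof (intro ballI impI)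
    fix f h assume "f \<in> (*) g ` T" "h \<in> (*) g ` T" "f \<noteq> h"
    then obtain a b where "f = g * a" "h = g * b" "a \<in> T" "b \<in> T" "a \<noteq> b" by auto
    then show "gcd f h = g" using T(2) gcd_monic_multiples[OF g0(2)] by (auto simp: pairwise_def)
  qed
  ultimately have "(*) g ` T \<in> CF k g" by (simp add: CF_eq)
  moreover have "card ((*) g ` T) = card (small_or_full (k - t) :: 'a poly set)"
    using g0(1) T(3) by (subst card_image) (auto simp: inj_on_def)
  ultimately show "card (small_or_full (k - t) :: 'a poly set) \<in> card ` CF k g"
    by (metis image_eqI)
qed

section \<open>Linear recurrences\<close>

text \<open>The length \<open>n\<close> is independent of \<open>degree p\<close>, because two
  kernels of length \<open>2 * k\<close> meet in such a space for a polynomial of smaller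
  degree.\<close>

definition recurrence_space :: "'a::field poly \<Rightarrow> nat \<Rightarrow> 'a vec set" where
  "recurrence_space p n = {x \<in> carrier_vec n.
     \<forall>i. i + degree p < n \<longrightarrow> (\<Sum>j\<le>degree p. coeff p j * x $ (i + j)) = 0}"

lemma CA_kernel_eq: "CA_kernel p = recurrence_space p (2 * degree p)"
  by (auto simp: CA_kernel_def recurrence_space_def linear_CA_def vec_eq_iff)

lemma recurrence_space_subspace:
  "VectorSpace.subspace class_ring (recurrence_space p n) (module_vec TYPE('a::field) n)"
proof (intro subspace.intro submodule.intro)
  show "vectorspace class_ring (module_vec TYPE('a) n)" by (rule vec_vs)
  show "module class_ring (module_vec TYPE('a) n)" by (rule vec_module)
qed (auto simp: recurrence_space_def module_vec_simps distrib_left sum.distrib mult.left_commute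
    simp flip: sum_distrib_left)

text \<open>As \<open>p\<close> is monic, each equation can be solved for its last entry, so the
  sequence is built one entry at a time.\<close>

lemma recurrence_extension:
  fixes p :: "'a::field poly"
  assumes p: "lead_coeff p = 1"
  shows "\<exists>s. (\<forall>i<degree p. s i = y i) \<and>
    (\<forall>i. i + degree p < n \<longrightarrow> (\<Sum>j\<le>degree p. coeff p j * s (i + j)) = 0)"
proof (induction n)
  case 0
  show ?case by auto
next
  case (Suc n)
  then obtain s where s: "\<forall>i<degree p. s i = y i"
    "\<And>i. i + degree p < n \<Longrightarrow> (\<Sum>j\<le>degree p. coeff p j * s (i + j)) = 0" by blast
  show ?case
  proof (cases "degree p \<le> n")
    case True
    \<comment> \<open>Only entry \<open>n\<close> changes. The equation with
      \<open>i + degree p = n\<close> dictates its value, and all earlier equations involve smaller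
      indices only.\<close>
    define s' where "s' = s(n := - (\<Sum>j<degree p. coeff p j * s (n - degree p + j)))"
    have "(\<Sum>j\<le>degree p. coeff p j * s' (i + j)) = 0" if "i + degree p < Suc n" for i
    proof (cases "i + degree p = n")
      case True
      then have "(\<Sum>j<degree p. coeff p j * s' (i + j)) = (\<Sum>j<degree p. coeff p j * s (n - degree p + j))"
        by (intro sum.cong) (auto simp: s'_def)
      moreover have "s' (i + degree p) = - (\<Sum>j<degree p. coeff p j * s (n - degree p + j))"
        using True by (simp add: s'_def)
      ultimately show ?thesis using p by (simp add: lessThan_Suc_atMost[symmetric])
    next
      case False
      then have "(\<Sum>j\<le>degree p. coeff p j * s' (i + j)) = (\<Sum>j\<le>degree p. coeff p j * s (i + j))"
        using that by (intro sum.cong) (auto simp: s'_def)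
      then show ?thesis using s(2)[of i] False that by simp
    qed
    moreover have "\<forall>i<degree p. s' i = y i" using s(1) True by (simp add: s'_def)
    ultimately show ?thesis by blast
  qed (use s(1) in auto)
qed

lemma recurrence_space_eqI:
  fixes p :: "'a::field poly"
  assumes p: "lead_coeff p = 1" and x: "x \<in> recurrence_space p n" and y: "y \<in> recurrence_space p n"
    and init: "\<And>i. i < degree p \<Longrightarrow> i < n \<Longrightarrow> x $ i = y $ i"
  shows "x = y"
proof (rule eq_vecI)
  show "dim_vec x = dim_vec y" using x y by (auto simp: recurrence_space_def)
  fix i assume "i < dim_vec y"
  then have "i < n" using y by (auto simp: recurrence_space_def)
  then show "x $ i = y $ i"
  proof (induction i rule: less_induct)
    case (less i)
    show ?case
    proof (cases "i < degree p")
      case True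
      then show ?thesis using init less.prems by simp
    next
      case False
      define l where "l = i - degree p"
      have i: "i = l + degree p" using False by (simp add: l_def)
      have rec: "z $ i = - (\<Sum>j<degree p. coeff p j * z $ (l + j))" if "z \<in> recurrence_space p n" for z
      proof -
        have "(\<Sum>j\<le>degree p. coeff p j * z $ (l + j)) = 0"
          using that less.prems i by (simp add: recurrence_space_def)
        then show ?thesis using p i by (simp add: lessThan_Suc_atMost[symmetric] eq_neg_iff_add_eq_0 add.commute)
      qed
      have "(\<Sum>j<degree p. coeff p j * x $ (l + j)) = (\<Sum>j<degree p. coeff p j * y $ (l + j))"
        using less i by (intro sum.cong) auto
      then show ?thesis using rec[OF x] rec[OF y] by simp
    qed
  qed
qed

text \<open>The map \<open>E\<close> from initial values to the solution with these values is a
  linear isomorphism from the space of dimension \<open>degree p\<close>.\<close>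

lemma dim_recurrence_space:
  fixes p :: "'a::field poly"
  assumes p: "lead_coeff p = 1" and n: "degree p \<le> n"
  shows "subspace_dim n (recurrence_space p n) = degree p"
proof -
  let ?d = "degree p" and ?R = "recurrence_space p n"
  let ?V = "module_vec TYPE('a) ?d" and ?W = "(module_vec TYPE('a) n)\<lparr>carrier := recurrence_space p n\<rparr>"
  have "\<exists>x. x \<in> ?R \<and> (\<forall>i<?d. x $ i = y $ i)" for y :: "'a vec"
  proof -
    obtain s where s: "\<forall>i<?d. s i = y $ i"
      "\<And>i. i + ?d < n \<Longrightarrow> (\<Sum>j\<le>?d. coeff p j * s (i + j)) = 0"
      using recurrence_extension[OF p, of "\<lambda>i. y $ i" n] by blast
    have "vec n s \<in> ?R" using s(2) by (auto simp: recurrence_space_def)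
    moreover have "\<forall>i<?d. vec n s $ i = y $ i" using s(1) n by auto
    ultimately show ?thesis by blast
  qed
  then have "\<exists>E. \<forall>y. E y \<in> ?R \<and> (\<forall>i<?d. E y $ i = y $ i)" by (intro choice allI)
  then obtain E where E: "\<And>y. E y \<in> ?R" "\<And>y i. i < ?d \<Longrightarrow> E y $ i = y $ i" by blast
  have carrier: "x \<in> carrier_vec n" if "x \<in> ?R" for x using that by (simp add: recurrence_space_def)
  \<comment> \<open>Uniqueness of solutions: additivity, homogeneity and surjectivity of
    \<open>E\<close> all reduce to comparing the first \<open>degree p\<close> entries.\<close>
  have E_eqI: "E y = x" if "x \<in> ?R" "\<And>i. i < ?d \<Longrightarrow> x $ i = y $ i" for x y
    by (rule recurrence_space_eqI[OF p E(1) that(1)]) (simp add: E that(2))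
  interpret R: submodule class_ring ?R "module_vec TYPE('a) n"
    using recurrence_space_subspace[of p n] by (simp add: subspace_def)
  have closed: "x + y \<in> ?R" if "x \<in> ?R" "y \<in> ?R" for x y
    using R.m_closed[OF that] by (simp add: module_vec_simps)
  have closed_smult: "c \<cdot>\<^sub>v x \<in> ?R" if "x \<in> ?R" for x c
    using R.smult_closed[of c x] that by (simp add: module_vec_simps)
  interpret V: vectorspace class_ring ?V by (rule vec_vs)
  interpret W: vectorspace class_ring ?W
    by (rule vectorspace.subspace_is_vs[OF vec_vs recurrence_space_subspace])
  have dims: "dim_vec (E y) = n" for y using carrier[OF E(1)] by auto
  have "E \<in> LinearCombinations.module_hom class_ring ?V ?W"
    unfolding LinearCombinations.module_hom_def
  proof (intro CollectI conjI allI impI)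
    show "E \<in> carrier ?V \<rightarrow> carrier ?W" using E(1) by simp
    fix y z assume "y \<in> carrier ?V \<and> z \<in> carrier ?V"
    then show "E (y \<oplus>\<^bsub>?V\<^esub> z) = E y \<oplus>\<^bsub>?W\<^esub> E z"
      using n by (intro E_eqI) (auto simp: module_vec_simps closed E dims)
  next
    fix c :: 'a and y assume "c \<in> carrier class_ring \<and> y \<in> carrier ?V"
    then show "E (c \<odot>\<^bsub>?V\<^esub> y) = c \<odot>\<^bsub>?W\<^esub> E y"
      using n by (intro E_eqI) (auto simp: module_vec_simps closed_smult E dims)
  qed
  then have "linear_map class_ring ?V ?W E"
    by (intro linear_map.intro mod_hom.intro mod_hom_axioms.intro V.vectorspace_axioms
        W.vectorspace_axioms V.module_axioms W.module_axioms)
  then interpret E: linear_map class_ring ?V ?W E .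
  have "V.dim = W.dim"
  proof (rule E.dim_eq)
    show "V.fin_dim" by (rule vec_space.fin_dim)
    show "inj_on E (carrier ?V)"
    proof
      fix y z assume yz: "y \<in> carrier ?V" "z \<in> carrier ?V" "E y = E z"
      show "y = z"
      proof (rule eq_vecI)
        fix i assume "i < dim_vec z"
        then have "i < ?d" using yz(2) by (simp add: module_vec_simps)
        then show "y $ i = z $ i" using E(2)[of i y] E(2)[of i z] yz(3) by simp
      qed (use yz in \<open>simp add: module_vec_simps\<close>)
    qed
    show "E ` carrier ?V = carrier ?W"
    proof (intro equalityI subsetI)
      fix x assume "x \<in> carrier ?W"
      then have "E (vec ?d (\<lambda>i. x $ i)) = x" by (intro E_eqI) auto
      then have "x = E (vec ?d (\<lambda>i. x $ i))" ..
      then show "x \<in> E ` carrier ?V" by (rule image_eqI) (simp add: module_vec_simps)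
    qed (use E(1) in auto)
  qed
  then show ?thesis by (simp add: subspace_dim_def vec_space.dim_is_n)
qed

section \<open>Vectors as functionals on polynomials\<close>

text \<open>The functional sending the \<open>j\<close>-th power of X to \<open>x $ j\<close>.
  Coefficients from index \<open>n\<close> on are ignored, hence the degree bounds wherever it is
  applied.\<close>

definition pairing :: "nat \<Rightarrow> 'a::field vec \<Rightarrow> 'a poly \<Rightarrow> 'a" where
  "pairing n x f = (\<Sum>j<n. coeff f j * x $ j)"

lemma pairing_add: "pairing n x (f + h) = pairing n x f + pairing n x h"
  by (simp add: pairing_def distrib_right sum.distrib)

lemma pairing_smult: "pairing n x (Polynomial.smult c f) = c * pairing n x f"
  by (simp add: pairing_def sum_distrib_left mult.assoc)

lemma pairing_0: "pairing n x 0 = 0"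
  by (simp add: pairing_def)

lemma pairing_sum: "pairing n x (\<Sum>i\<in>A. f i) = (\<Sum>i\<in>A. pairing n x (f i))"
  by (induction A rule: infinite_finite_induct) (simp_all add: pairing_0 pairing_add)

lemma pairing_shift:
  assumes "i + degree p < n"
  shows "pairing n x (monom 1 i * p) = (\<Sum>j\<le>degree p. coeff p j * x $ (i + j))"
proof -
  have "pairing n x (monom 1 i * p) = (\<Sum>j\<in>{i..i + degree p}. coeff p (j - i) * x $ j)"
    unfolding pairing_def using assms
    by (intro sum.mono_neutral_cong_right) (auto simp: coeff_monom_mult coeff_eq_0)
  also have "\<dots> = (\<Sum>j\<le>degree p. coeff p j * x $ (i + j))"
    by (rule sum.reindex_bij_witness[where i = "\<lambda>j. i + j" and j = "\<lambda>j. j - i"]) auto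
  finally show ?thesis .
qed

text \<open>The recurrence equations say that the functional kills the shifts
  \<open>monom 1 i * p\<close> of degree below \<open>n\<close>, and these span all multiples of
  \<open>p\<close> of degree below \<open>n\<close>.\<close>

lemma recurrence_space_iff:
  assumes p: "p \<noteq> 0"
  shows "x \<in> recurrence_space p n \<longleftrightarrow>
    x \<in> carrier_vec n \<and> (\<forall>h. degree (h * p) < n \<longrightarrow> pairing n x (h * p) = 0)"
proof (intro iffI conjI allI impI)
  assume x: "x \<in> recurrence_space p n"
  then show "x \<in> carrier_vec n" by (simp add: recurrence_space_def)
  fix h assume "degree (h * p) < n"
  then have deg: "degree h + degree p < n" if "h \<noteq> 0" using p that by (simp add: degree_mult_eq)
  show "pairing n x (h * p) = 0"
  proof (cases "h = 0")
    case False
    have "h * p = (\<Sum>i\<le>degree h. Polynomial.smult (coeff h i) (monom 1 i * p))"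
      by (subst poly_as_sum_of_monoms[of h, symmetric])
        (simp add: sum_distrib_right smult_monom flip: mult_smult_left)
    also have "pairing n x \<dots> = (\<Sum>i\<le>degree h. coeff h i * pairing n x (monom 1 i * p))"
      by (simp add: pairing_sum pairing_smult)
    also have "\<dots> = 0"
      using x deg[OF False] by (intro sum.neutral) (auto simp: pairing_shift recurrence_space_def)
    finally show ?thesis .
  qed (simp add: pairing_0)
next
  assume *: "x \<in> carrier_vec n \<and> (\<forall>h. degree (h * p) < n \<longrightarrow> pairing n x (h * p) = 0)"
  have "(\<Sum>j\<le>degree p. coeff p j * x $ (i + j)) = 0" if "i + degree p < n" for i
  proof -
    have "degree (monom 1 i * p) < n" using that p by (simp add: degree_mult_eq degree_monom_eq)
    then show ?thesis using * pairing_shift[OF that, of x] by simp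
  qed
  with * show "x \<in> recurrence_space p n" by (simp add: recurrence_space_def)
qed

text \<open>Needs a Bezout representation of \<open>h * g\<close> by multiples of
  \<open>g * a\<close> and \<open>g * b\<close> that both stay below degree \<open>n\<close>, since
  the functionals see nothing beyond.\<close>

lemma recurrence_space_Int:
  fixes g a b :: "'a::field_gcd poly"
  assumes ab: "coprime a b" "a \<noteq> 0" "b \<noteq> 0" and g: "g \<noteq> 0"
    and n: "degree (g * a) + degree b \<le> n"
  shows "recurrence_space (g * a) n \<inter> recurrence_space (g * b) n = recurrence_space g n"
proof (intro equalityI subsetI)
  fix x assume x: "x \<in> recurrence_space (g * a) n \<inter> recurrence_space (g * b) n"
  have "pairing n x (h * g) = 0" if h: "degree (h * g) < n" for h
  proof -
    obtain u0 v0 where "u0 * a + v0 * b = 1"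
      using bezout_coefficients_fst_snd[of a b] ab(1) by (auto simp: coprime_iff_gcd_eq_1)
    \<comment> \<open>Reducing the Bezout coefficient modulo \<open>b\<close> bounds the degree of
      \<open>u\<close>; for constant \<open>b\<close> the remainder is 0. The quotient is moved into
      \<open>v\<close>.\<close>
    obtain q u where qu: "h * u0 = q * b + u" and deg_u: "u = 0 \<or> degree u < degree b"
    proof
      show "h * u0 = (h * u0) div b * b + (h * u0) mod b" by simp
      show "(h * u0) mod b = 0 \<or> degree ((h * u0) mod b) < degree b" by (rule degree_mod_less[OF ab(3)])
    qed
    define v where "v = h * v0 + q * a"
    have "h = (h * u0) * a + h * v0 * b"
      by (metis \<open>u0 * a + v0 * b = 1\<close> distrib_left mult.assoc mult.right_neutral)
    then have uv: "h = u * a + v * b" by (simp add: qu v_def algebra_simps)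
    have u: "degree (u * (g * a)) < n"
    proof (cases "u = 0")
      case False
      then have "degree u < degree b" using deg_u by simp
      moreover have "degree (u * (g * a)) = degree u + degree (g * a)"
        using False ab g by (intro degree_mult_eq) auto
      ultimately show ?thesis using n by linarith
    qed (use h in simp)
    have hg: "h * g = u * (g * a) + v * (g * b)" by (subst uv) (simp add: algebra_simps)
    \<comment> \<open>No direct bound on \<open>v\<close> is required: its term is a difference of
      two polynomials of degree below \<open>n\<close>.\<close>
    then have "v * (g * b) = h * g - u * (g * a)" by simp
    then have v: "degree (v * (g * b)) < n" using degree_diff_less[OF h u] by simp
    have "pairing n x (u * (g * a)) = 0" "pairing n x (v * (g * b)) = 0"
      using x u v ab g by (auto simp: recurrence_space_iff)
    then show ?thesis by (simp add: hg pairing_add)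
  qed
  then show "x \<in> recurrence_space g n" using x g ab by (auto simp: recurrence_space_iff)
next
  fix x assume "x \<in> recurrence_space g n"
  then have x: "x \<in> carrier_vec n" "\<And>h. degree (h * g) < n \<Longrightarrow> pairing n x (h * g) = 0"
    using g by (auto simp: recurrence_space_iff)
  then show "x \<in> recurrence_space (g * a) n \<inter> recurrence_space (g * b) n"
    using x(2)[of "_ * a"] x(2)[of "_ * b"] g ab by (simp add: recurrence_space_iff ac_simps)
qed

section \<open>The Grassmannian code\<close>

text \<open>The length \<open>2 * k\<close> accommodates the Bezout bound, as
  \<open>k + (k - t) \<le> 2 * k\<close>. The kernels have dimension \<open>k\<close> and their
  intersection has dimension \<open>t\<close>.\<close>

lemma CA_kernel_dist:
  fixes g :: "'a::field_gcd poly"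
  assumes t: "t < k" and g: "g \<in> monics t" and P: "P \<in> monics k" and Q: "Q \<in> monics k"
    and gcd: "gcd P Q = g"
  shows "subspace_dist (2 * k) (CA_kernel P) (CA_kernel Q) = 2 * int k - 2 * int t"
proof -
  have g0: "g \<noteq> 0" "lead_coeff g = 1" "degree g = t" using monicsD[OF g] by auto
  obtain a b where ab: "P = g * a" "Q = g * b" using gcd gcd_dvd1[of P Q] gcd_dvd2[of P Q] by (auto elim!: dvdE)
  then have cop: "coprime a b" using gcd gcd_monic_multiples[OF g0(2)] by simp
  have b: "b \<in> monics (k - t)" "a \<noteq> 0" "b \<noteq> 0"
    using P Q monics_cofactor[OF g] monicsD unfolding ab by blast+
  have kernel: "CA_kernel R = recurrence_space R (2 * k)"
    and dim: "subspace_dim (2 * k) (CA_kernel R) = k" if "R \<in> monics k" for R :: "'a poly"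
  proof -
    have R: "degree R = k" "lead_coeff R = 1" using monicsD[OF that] by auto
    show *: "CA_kernel R = recurrence_space R (2 * k)" using R(1) by (simp add: CA_kernel_eq)
    show "subspace_dim (2 * k) (CA_kernel R) = k"
      using dim_recurrence_space[OF R(2), of "2 * k"] R(1) by (simp add: *)
  qed
  have "CA_kernel P \<inter> CA_kernel Q = recurrence_space g (2 * k)"
    unfolding kernel[OF P] kernel[OF Q] unfolding ab
  proof (rule recurrence_space_Int[OF cop b(2,3) g0(1)])
    show "degree (g * a) + degree b \<le> 2 * k"
      using monicsD[OF P] monicsD[OF b(1)] by (simp add: ab)
  qed
  moreover have "subspace_dim (2 * k) (recurrence_space g (2 * k)) = t"
    using dim_recurrence_space[OF g0(2), of "2 * k"] g0(3) t by simp
  ultimately show ?thesis by (simp add: subspace_dist_def dim P Q)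
qed

lemma CA_kernel_code:
  fixes g :: "'a::field_gcd poly"
  assumes t: "t < k" and g: "g \<in> monics t" and S: "S \<in> CF k g" and card: "card S \<ge> 2"
  shows "grassmannian_code (2 * k) (CA_kernel ` S)"
    and "equidistant (2 * k) (CA_kernel ` S) (2 * int k - 2 * int t)"
    and "min_distance (2 * k) (CA_kernel ` S) = 2 * int k - 2 * int t"
proof -
  have monic: "P \<in> monics k" if "P \<in> S" for P using S that by (auto simp: CF_eq)
  have dist: "subspace_dist (2 * k) (CA_kernel P) (CA_kernel Q) = 2 * int k - 2 * int t"
    if "P \<in> S" "Q \<in> S" "P \<noteq> Q" for P Q
    using S that by (intro CA_kernel_dist[OF t g monic monic]) (auto simp: CF_eq pairwise_def)
  have "VectorSpace.subspace class_ring (CA_kernel P) (module_vec TYPE('a) (2 * k))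
      \<and> subspace_dim (2 * k) (CA_kernel P) = k" if "P \<in> S" for P
    using monicsD[OF monic[OF that]] recurrence_space_subspace[of P "2 * k"]
      dim_recurrence_space[of P "2 * k"] by (auto simp: CA_kernel_eq)
  then show "grassmannian_code (2 * k) (CA_kernel ` S)"
    by (auto simp: grassmannian_code_def)
  show "equidistant (2 * k) (CA_kernel ` S) (2 * int k - 2 * int t)"
    unfolding equidistant_def using dist by blast
  obtain P Q where PQ: "P \<in> S" "Q \<in> S" "P \<noteq> Q"
    using card by (metis card_le_Suc0_iff_eq card.infinite not_numeral_le_zero not_less_eq_eq numeral_2_eq_2)
  \<comment> \<open>Distinct polynomials give distinct codewords because \<open>t < k\<close> makes
    the distance nonzero. So the set of distances is a nonempty singleton and its \<open>Min\<close>
    is meaningful.\<close>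
  have "CA_kernel P \<noteq> CA_kernel Q"
  proof
    assume "CA_kernel P = CA_kernel Q"
    then have "subspace_dist (2 * k) (CA_kernel P) (CA_kernel Q) = 0" by (simp add: subspace_dist_def)
    then show False using dist[OF PQ] t by simp
  qed
  moreover have "d = 2 * int k - 2 * int t"
    if "d \<in> {subspace_dist (2 * k) A B | A B. A \<in> CA_kernel ` S \<and> B \<in> CA_kernel ` S \<and> A \<noteq> B}" for d
    using that dist by blast
  ultimately have "{subspace_dist (2 * k) A B | A B. A \<in> CA_kernel ` S \<and> B \<in> CA_kernel ` S \<and> A \<noteq> B}
      = {2 * int k - 2 * int t}"
    using PQ(1,2) dist[OF PQ, symmetric] by blast
  then show "min_distance (2 * k) (CA_kernel ` S) = 2 * int k - 2 * int t"
    by (simp add: min_distance_def)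
qed

theorem mainTheorem4:
  fixes k t :: nat and g :: "'a::{field_gcd, finite} poly"
  assumes "t < k"
    and "lead_coeff g = 1" and "degree g = t" and "poly g 0 \<noteq> 0"
  shows
    "(\<forall>n\<ge>1. (of_nat (num_irreducible TYPE('a) n) :: rat)
        = 1 / of_nat n * (\<Sum>d | d dvd n. of_int (moebius d) * of_nat (CARD('a)) ^ (n div d))) \<and>
     (\<forall>n\<ge>1. num_irreducible TYPE('a) n
        = num_irreducible_nz TYPE('a) n + (if n = 1 then 1 else 0)) \<and>
     Max (card ` CF k g)
        = num_irreducible_nz TYPE('a) (k - t)
          + (\<Sum>i = 1..(k - t) div 2. num_irreducible_nz TYPE('a) i) \<and>
     (\<forall>S \<in> CF k g. card S \<ge> 2 \<longrightarrow>
        grassmannian_code (2 * k) (CA_kernel ` S) \<and>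
        equidistant (2 * k) (CA_kernel ` S) (2 * int k - 2 * int t) \<and>
        min_distance (2 * k) (CA_kernel ` S) = 2 * int k - 2 * int t)"
proof (intro conjI allI ballI impI)
  have g: "g \<in> monics t" using assms(2,3) by (simp add: monics_def)
  show "Max (card ` CF k g)
      = num_irreducible_nz TYPE('a) (k - t) + (\<Sum>i = 1..(k - t) div 2. num_irreducible_nz TYPE('a) i)"
    using Max_card_CF[OF assms(1) g assms(4)] card_small_or_full[of "k - t", where 'a='a] assms(1) by simp
  fix S assume S: "S \<in> CF k g" "card S \<ge> 2"
  show "grassmannian_code (2 * k) (CA_kernel ` S)"
    and "equidistant (2 * k) (CA_kernel ` S) (2 * int k - 2 * int t)"
    and "min_distance (2 * k) (CA_kernel ` S) = 2 * int k - 2 * int t"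
    by (rule CA_kernel_code[OF assms(1) g S])+
qed (rule gauss_formula num_irreducible_eq_nz, assumption?)+

end
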